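(* Let $H$ be a real separable Hilbert space with Borel $\sigma$-algebra $\mathcal B(H)$. Let $I_1$ and $I_2$ be two disjoint countable index sets. Let $(\gamma_i)_{i\in I_1}$ and $(\tau_j)_{j\in I_2}$ be Gaussian probability measures on $(H,\mathcal B(H))$ such that $\gamma_i\perp\tau_j$ for every $i\in I_1$ and every $j\in I_2$. Define $$\mu=\sum_{i\in I_1}\pi_i\gamma_i,\qquad \nu=\sum_{j\in I_2}\rho_j\tau_j,$$ where $\pi_i,\rho_j\ge0$, $\sum_{i\in I_1}\pi_i=1$ and $\sum_{j\in I_2}\rho_j=1$. Then $\mu\perp\nu$.
   Context: Two probability measures $\alpha,\beta$ on $(H,\mathcal B(H))$ are mutually singular, $\alpha\perp\beta$, if there is $A\in\mathcal B(H)$ with $\alpha(A)=1$ and $\beta(A)=0$. Sums of measures are taken setwise: $\mu(A)=\sum_{i\in I_1}\pi_i\gamma_i(A)$ and $\nu(A)=\sum_{j\in I_2}\rho_j\tau_j(A)$ for $A\in\mathcal B(H)$. *)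

theory Defs
  imports "HOL-Probability.Probability"
begin

text \<open>Degenerate (Dirac) laws count as Gaussian, as is standard in infinite dimensions, where
  covariance operators may have a nontrivial kernel. They are listed separately because
  \<^term>\<open>normal_density m 0\<close> is identically zero.\<close>

definition gaussian_real :: "real measure \<Rightarrow> bool" where
  "gaussian_real N \<longleftrightarrow>
     (\<exists>m. N = return borel m) \<or>
     (\<exists>m \<sigma>. \<sigma> > 0 \<and> N = density lborel (\<lambda>x. ennreal (normal_density m \<sigma> x)))"

text \<open>By the Riesz representation theorem, the maps \<open>\<lambda>x. x \<bullet> h\<close> are all the continuous linear
  functionals on a Hilbert space.\<close>

definition gaussian_measure :: "'h::{real_inner,polish_space} measure \<Rightarrow> bool" where
  "gaussian_measure M \<longleftrightarrow>
     prob_space M \<and> sets M = sets borel \<and>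
     (\<forall>h. gaussian_real (distr M borel (\<lambda>x. x \<bullet> h)))"

definition mutually_singular :: "'h::topological_space measure \<Rightarrow> 'h measure \<Rightarrow> bool" where
  "mutually_singular M N \<longleftrightarrow> (\<exists>A\<in>sets borel. emeasure M A = 1 \<and> emeasure N A = 0)"

definition mixture :: "'i set \<Rightarrow> ('i \<Rightarrow> real) \<Rightarrow> ('i \<Rightarrow> 'h::topological_space measure) \<Rightarrow> 'h measure" where
  "mixture I w M =
     measure_of UNIV (sets borel) (\<lambda>A. \<Sum>\<^sub>\<infinity>i\<in>I. ennreal (w i) * emeasure (M i) A)"

lemma space_mixture [simp]: "space (mixture I w M) = UNIV"
  unfolding mixture_def by (rule space_measure_of) simp

lemma sets_mixture [simp, measurable_cong]: "sets (mixture I w M) = sets borel"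
  unfolding mixture_def using sets.sigma_sets_eq[of borel] by simp

lemma infsum_ennreal_eq_SUP:
  fixes f :: "'i \<Rightarrow> ennreal"
  shows "infsum f I = (SUP F\<in>{F. finite F \<and> F \<subseteq> I}. sum f F)"
  by (rule infsumI, rule nonneg_has_sum_complete) simp

lemma infsum_ennreal_eq_nn_integral:
  fixes f :: "'i \<Rightarrow> ennreal"
  assumes "countable I"
  shows "infsum f I = (\<integral>\<^sup>+i. f i \<partial>count_space I)"
proof (cases "finite I")
  case True
  then show ?thesis by (simp add: nn_integral_count_space_finite)
next
  case False
  let ?g = "from_nat_into I"
  have g: "bij_betw ?g UNIV I"
    using assms False by (rule bij_betw_from_nat_into)
  have "(\<integral>\<^sup>+i. f i \<partial>count_space I) = (\<integral>\<^sup>+n. f (?g n) \<partial>count_space UNIV)"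
    by (rule nn_integral_bij_count_space[OF g, symmetric])
  also have "\<dots> = (SUP n. \<Sum>k<n. f (?g k))"
    by (simp add: nn_integral_count_space_nat suminf_eq_SUP)
  also have "\<dots> = (SUP F\<in>{F. finite F \<and> F \<subseteq> I}. sum f F)"
  proof (rule antisym)
    show "(SUP n. \<Sum>k<n. f (?g k)) \<le> (SUP F\<in>{F. finite F \<and> F \<subseteq> I}. sum f F)"
    proof (rule SUP_least)
      fix n
      have "inj_on ?g {..<n}"
        using g by (meson bij_betw_def inj_on_subset subset_UNIV)
      then have "(\<Sum>k<n. f (?g k)) = sum f (?g ` {..<n})"
        by (simp add: sum.reindex)
      moreover have "?g ` {..<n} \<subseteq> I"
        using g by (auto simp: bij_betw_def)
      ultimately show "(\<Sum>k<n. f (?g k)) \<le> (SUP F\<in>{F. finite F \<and> F \<subseteq> I}. sum f F)"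
        by (auto intro!: SUP_upper2[of "?g ` {..<n}"])
    qed
    show "(SUP F\<in>{F. finite F \<and> F \<subseteq> I}. sum f F) \<le> (SUP n. \<Sum>k<n. f (?g k))"
    proof (rule SUP_least)
      fix F assume F: "F \<in> {F. finite F \<and> F \<subseteq> I}"
      let ?K = "?g -` F"
      have inj: "inj ?g" using g by (simp add: bij_betw_def)
      have "finite ?K" using F inj by (auto intro: finite_vimageI)
      then obtain n where n: "?K \<subseteq> {..<n}" using finite_nat_iff_bounded by blast
      have "?g ` ?K = F" using F g by (auto simp: bij_betw_def)
      then have "sum f F = (\<Sum>k\<in>?K. f (?g k))"
        using inj by (metis (no_types, lifting) sum.reindex_cong inj_on_subset subset_UNIV)
      also have "\<dots> \<le> (\<Sum>k<n. f (?g k))" using n by (intro sum_mono2) auto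
      finally show "sum f F \<le> (SUP n. \<Sum>k<n. f (?g k))"
        by (rule SUP_upper2[rotated]) simp
    qed
  qed
  finally show ?thesis by (simp add: infsum_ennreal_eq_SUP)
qed

text \<open>The setwise sum is indeed countably additive, so \<^const>\<open>mixture\<close> is not the null measure that
  \<^const>\<open>measure_of\<close> returns otherwise.\<close>

lemma emeasure_mixture:
  fixes M :: "'i \<Rightarrow> 'h::topological_space measure"
  assumes "countable I" and "\<And>i. i \<in> I \<Longrightarrow> sets (M i) = sets borel" and A: "A \<in> sets borel"
  shows "emeasure (mixture I w M) A = (\<Sum>\<^sub>\<infinity>i\<in>I. ennreal (w i) * emeasure (M i) A)"
proof (rule emeasure_measure_of[OF mixture_def])
  show "sets (borel :: 'h measure) \<subseteq> Pow UNIV" by simp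
  show "A \<in> sets (mixture I w M)" using A by simp
  show "positive (sets (mixture I w M)) (\<lambda>A. \<Sum>\<^sub>\<infinity>i\<in>I. ennreal (w i) * emeasure (M i) A)"
    by (simp add: positive_def)
  show "countably_additive (sets (mixture I w M)) (\<lambda>A. \<Sum>\<^sub>\<infinity>i\<in>I. ennreal (w i) * emeasure (M i) A)"
  proof (rule countably_additiveI)
    fix B :: "nat \<Rightarrow> 'h set"
    assume B: "range B \<subseteq> sets (mixture I w M)" "disjoint_family B"
    have "(\<Sum>n. \<integral>\<^sup>+i. ennreal (w i) * emeasure (M i) (B n) \<partial>count_space I)
        = (\<integral>\<^sup>+i. (\<Sum>n. ennreal (w i) * emeasure (M i) (B n)) \<partial>count_space I)"
      by (rule nn_integral_suminf[symmetric]) simp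
    also have "\<dots> = (\<integral>\<^sup>+i. ennreal (w i) * emeasure (M i) (\<Union>n. B n) \<partial>count_space I)"
    proof (rule nn_integral_cong)
      fix i assume "i \<in> space (count_space I)"
      then have "range B \<subseteq> sets (M i)" using B assms(2) by simp
      then show "(\<Sum>n. ennreal (w i) * emeasure (M i) (B n)) = ennreal (w i) * emeasure (M i) (\<Union>n. B n)"
        using B(2) by (simp add: suminf_emeasure)
    qed
    finally show "(\<Sum>n. \<Sum>\<^sub>\<infinity>i\<in>I. ennreal (w i) * emeasure (M i) (B n))
        = (\<Sum>\<^sub>\<infinity>i\<in>I. ennreal (w i) * emeasure (M i) (\<Union>n. B n))"
      using assms(1) by (simp add: infsum_ennreal_eq_nn_integral)
  qed
qed

lemma prob_space_mixture:
  fixes M :: "'i \<Rightarrow> 'h::topological_space measure"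
  assumes "countable I" and "\<And>i. i \<in> I \<Longrightarrow> sets (M i) = sets borel"
    and "\<And>i. i \<in> I \<Longrightarrow> prob_space (M i)"
    and "\<And>i. i \<in> I \<Longrightarrow> 0 \<le> w i" and "(w has_sum 1) I"
  shows "prob_space (mixture I w M)"
proof (rule prob_spaceI)
  have "ennreal (w i) * emeasure (M i) UNIV = ennreal (w i)" if "i \<in> I" for i
    using prob_space.emeasure_space_1[OF assms(3)[OF that]] sets_eq_imp_space_eq[OF assms(2)[OF that]]
    by simp
  then have "emeasure (mixture I w M) UNIV = (\<Sum>\<^sub>\<infinity>i\<in>I. ennreal (w i))"
    using assms(1,2) by (simp add: emeasure_mixture cong: infsum_cong)
  also have "\<dots> = (SUP F\<in>{F. finite F \<and> F \<subseteq> I}. ennreal (sum w F))"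
    unfolding infsum_ennreal_eq_SUP using assms(4) by (intro SUP_cong refl sum_ennreal) auto
  also have "\<dots> = ennreal (infsum w I)"
    using assms(4,5) by (intro infsum_nonneg_is_SUPREMUM_ennreal[symmetric]) (auto simp: summable_on_def)
  also have "\<dots> = 1"
    using infsumI[OF assms(5)] by simp
  finally show "emeasure (mixture I w M) (space (mixture I w M)) = 1" by simp
qed

end

theory Submission
  imports Defs
begin

text \<open>If \<open>A i j\<close> separates \<open>M i\<close> from \<open>N j\<close>, then \<open>\<Union>i. \<Inter>j. A i j\<close> separates all \<open>M i\<close> from all \<open>N j\<close>
  simultaneously, hence also their mixtures.\<close>

lemma mutually_singular_family:
  fixes M :: "'i \<Rightarrow> 'h::topological_space measure" and N :: "'j \<Rightarrow> 'h measure"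
  assumes "countable I" and "countable J"
    and M: "\<And>i. i \<in> I \<Longrightarrow> prob_space (M i)" "\<And>i. i \<in> I \<Longrightarrow> sets (M i) = sets borel"
    and N: "\<And>j. j \<in> J \<Longrightarrow> sets (N j) = sets borel"
    and "\<And>i j. i \<in> I \<Longrightarrow> j \<in> J \<Longrightarrow> mutually_singular (M i) (N j)"
  shows "\<exists>A\<in>sets borel. (\<forall>i\<in>I. emeasure (M i) A = 1) \<and> (\<forall>j\<in>J. emeasure (N j) A = 0)"
proof -
  \<comment> \<open>Separating sets exist pair by pair; choice turns them into one family, which the
    countable operations below can combine.\<close>
  have "\<exists>A. \<forall>i\<in>I. \<forall>j\<in>J. A i j \<in> sets borel \<and> emeasure (M i) (A i j) = 1 \<and> emeasure (N j) (A i j) = 0"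
    using assms(6) unfolding mutually_singular_def by metis
  then obtain A where A: "\<And>i j. i \<in> I \<Longrightarrow> j \<in> J \<Longrightarrow> A i j \<in> sets borel"
    "\<And>i j. i \<in> I \<Longrightarrow> j \<in> J \<Longrightarrow> emeasure (M i) (A i j) = 1"
    "\<And>i j. i \<in> I \<Longrightarrow> j \<in> J \<Longrightarrow> emeasure (N j) (A i j) = 0"
    by blast
  \<comment> \<open>\<open>B i\<close> keeps full \<open>M i\<close>-measure while being null for
    every \<open>N j\<close> at once. If \<open>J\<close> is empty, it is
    \<open>UNIV\<close>.\<close>
  define B where "B i = (\<Inter>j\<in>J. A i j)" for i
  have B: "B i \<in> sets borel" if "i \<in> I" for i
    unfolding B_def using A(1) that \<open>countable J\<close> by (intro sets.countable_INT'') auto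
  have U: "(\<Union>i\<in>I. B i) \<in> sets borel"
    using B \<open>countable I\<close> by (intro sets.countable_UN') auto
  show ?thesis
  proof (intro bexI conjI ballI)
    show "(\<Union>i\<in>I. B i) \<in> sets borel" by (fact U)
    show "emeasure (M i) (\<Union>i\<in>I. B i) = 1" if i: "i \<in> I" for i
    proof -
      interpret prob_space "M i" using M(1)[OF i] .
      \<comment> \<open>Measure one is restated as an almost-everywhere property because such
        properties are stable under countable conjunction; this is where countability of
        \<open>J\<close> gives \<open>B i\<close> full measure.\<close>
      have "AE x in M i. x \<in> A i j" if "j \<in> J" for j
        using A(1,2)[OF i that] M(2)[OF i] by (simp add: prob_eq_1[symmetric] emeasure_eq_measure)
      then have "AE x in M i. \<forall>j\<in>J. x \<in> A i j"
        using \<open>countable J\<close> by (simp add: AE_ball_countable)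
      then have "AE x in M i. x \<in> (\<Union>i\<in>I. B i)"
        by eventually_elim (use i in \<open>auto simp: B_def\<close>)
      then show ?thesis
        using U M(2)[OF i] by (intro emeasure_eq_1_AE) auto
    qed
    show "emeasure (N j) (\<Union>i\<in>I. B i) = 0" if j: "j \<in> J" for j
    proof -
      \<comment> \<open>For a fixed \<open>j\<close>, the single factor \<open>A i j\<close> of the
        intersection already forces \<open>B i\<close> to be null. Countability of \<open>I\<close>
        then carries this over to the union.\<close>
      have "B i \<in> null_sets (N j)" if "i \<in> I" for i
      proof (rule null_sets_subset)
        show "A i j \<in> null_sets (N j)" using A(1,3)[OF that j] N[OF j] by auto
        show "B i \<in> sets (N j)" using B[OF that] N[OF j] by simp
        show "B i \<subseteq> A i j" using j by (auto simp: B_def)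
      qed
      then show ?thesis using null_sets_UN'[OF \<open>countable I\<close>] by blast
    qed
  qed
qed

theorem lemma2p3:
  fixes I1 I2 :: "'i set"
    and \<gamma> \<tau> :: "'i \<Rightarrow> 'h::{real_inner,polish_space} measure"
    and \<pi> \<rho> :: "'i \<Rightarrow> real"
    and \<mu> \<nu> :: "'h measure"
  assumes "countable I1" and "countable I2" and "I1 \<inter> I2 = {}"
    and "\<And>i. i \<in> I1 \<Longrightarrow> gaussian_measure (\<gamma> i)"
    and "\<And>j. j \<in> I2 \<Longrightarrow> gaussian_measure (\<tau> j)"
    and "\<And>i j. i \<in> I1 \<Longrightarrow> j \<in> I2 \<Longrightarrow> mutually_singular (\<gamma> i) (\<tau> j)"
    and "\<And>i. i \<in> I1 \<Longrightarrow> 0 \<le> \<pi> i" and "\<And>j. j \<in> I2 \<Longrightarrow> 0 \<le> \<rho> j"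
    and "(\<pi> has_sum 1) I1" and "(\<rho> has_sum 1) I2"
    and "\<mu> = mixture I1 \<pi> \<gamma>" and "\<nu> = mixture I2 \<rho> \<tau>"
  shows "mutually_singular \<mu> \<nu>"
proof -
  have \<gamma>: "prob_space (\<gamma> i)" "sets (\<gamma> i) = sets borel" if "i \<in> I1" for i
    using assms(4)[OF that] by (auto simp: gaussian_measure_def)
  have \<tau>: "sets (\<tau> j) = sets borel" if "j \<in> I2" for j
    using assms(5)[OF that] by (auto simp: gaussian_measure_def)
  \<comment> \<open>A set independent of both indices is essential: a mixture evaluates all of its
    components on the same set.\<close>
  obtain A where A: "A \<in> sets borel"
    and 1: "\<And>i. i \<in> I1 \<Longrightarrow> emeasure (\<gamma> i) A = 1" and 0: "\<And>j. j \<in> I2 \<Longrightarrow> emeasure (\<tau> j) A = 0"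
    using mutually_singular_family[of I1 I2 \<gamma> \<tau>] assms(1,2,6) \<gamma> \<tau> by auto
  interpret \<mu>: prob_space \<mu>
    unfolding assms(11) using assms(1,7,9) \<gamma> by (intro prob_space_mixture) auto
  have UNIV1: "emeasure (\<gamma> i) UNIV = 1" if "i \<in> I1" for i
    using prob_space.emeasure_space_1[OF \<gamma>(1)[OF that]] sets_eq_imp_space_eq[OF \<gamma>(2)[OF that]] by simp
  \<comment> \<open>The two sums agree term by term, since each \<gamma>-component gives mass 1 to
    both sets. The normalisation of the weights then enters only through the total mass of
    \<mu>.\<close>
  have "emeasure \<mu> A = emeasure \<mu> UNIV"
    unfolding assms(11) using assms(1) \<gamma>(2) A 1 UNIV1
    by (simp add: emeasure_mixture cong: infsum_cong)
  also have "\<dots> = 1"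
    using \<mu>.emeasure_space_1 by (simp add: assms(11))
  finally have "emeasure \<mu> A = 1" .
  moreover have "emeasure \<nu> A = 0"
    unfolding assms(12) using assms(2) \<tau> A 0 by (simp add: emeasure_mixture cong: infsum_cong)
  ultimately show ?thesis
    using A unfolding mutually_singular_def by blast
qed

end
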